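(* Let $d \geq 1$ and let $\{a^1,b^1\},\ldots,\{a^t,b^t\}$ be a collection of $t$ pairs of points in $\mathbb{R}^d$ such that for each $j$ the points $a^j, b^j$ are non-intersecting, but all $2t$ points are otherwise pairwise intersecting (that is, for all $j \neq k$, each of $a^j, b^j$ intersects each of $a^k, b^k$). Then $t \leq 2^{d-1}$.
   Context: Two points $x,y \in \mathbb{R}^d$ are intersecting if they agree in some coordinate, i.e. $x_i = y_i$ for some $i \in \{1,\ldots,d\}$; otherwise they are non-intersecting. *)

theory Defs
  imports "HOL-Analysis.Analysis"
begin

definition intersecting :: "real ^ 'd \<Rightarrow> real ^ 'd \<Rightarrow> bool"
  where "intersecting x y \<longleftrightarrow> (\<exists>i. x $ i = y $ i)"

end

theory Submission
  imports Defs
begin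

text \<open>
  The proof is the polynomial method of linear algebra. Two points \<open>x\<close>, \<open>y\<close> intersect exactly when
  the product of the differences \<open>x\<^sub>i - y\<^sub>i\<close> vanishes. Expanding this product over the subsets of
  coordinates writes it as an inner product of a vector depending only on \<open>x\<close> (the multilinear
  monomials at \<open>x\<close>) with a vector depending only on \<open>y\<close>, both in a space of dimension \<open>2\<^sup>d\<close>
  (\<open>inner_monomials_complementary\<close>).

  Among the \<open>2t\<close> given points, the only point that fails to intersect a given one is its partner;
  in particular a point intersects itself because \<open>d \<ge> 1\<close>. Hence the monomial vectors of the points
  and the complementary vectors of their partners form a biorthogonal system of size \<open>2t\<close>, so
  \<open>2t \<le> 2\<^sup>d\<close> by \<open>card_le_DIM_biorthogonal\<close>.
\<close>

text \<open>
  Pairing a linear relation among the \<open>v p\<close> with \<open>w q\<close> isolates the coefficient at \<open>q\<close>, so the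
  \<open>v p\<close> are distinct and linearly independent.
\<close>

lemma card_le_DIM_biorthogonal:
  fixes v w :: "'i \<Rightarrow> 'e::euclidean_space"
  assumes diag: "\<And>p. p \<in> I \<Longrightarrow> v p \<bullet> w p \<noteq> 0"
    and off_diag: "\<And>p q. p \<in> I \<Longrightarrow> q \<in> I \<Longrightarrow> p \<noteq> q \<Longrightarrow> v p \<bullet> w q = 0"
  shows "card I \<le> DIM('e)"
proof -
  have inj: "inj_on v I"
    by (rule inj_onI) (metis diag off_diag)
  have "independent (v ` I)"
  proof
    assume "dependent (v ` I)"
    then obtain T u q where T: "finite T" "T \<subseteq> v ` I" and zero: "(\<Sum>x\<in>T. u x *\<^sub>R x) = 0"
      and q: "q \<in> T" and nz: "u q \<noteq> 0"
      unfolding dependent_explicit by blast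
    obtain p where p: "p \<in> I" "q = v p"
      using T q by blast
    have others: "x \<bullet> w p = 0" if "x \<in> T - {q}" for x
      using that T p off_diag by blast
    have "0 = (\<Sum>x\<in>T. u x *\<^sub>R x) \<bullet> w p"
      by (simp add: zero)
    also have "\<dots> = (\<Sum>x\<in>T. u x * (x \<bullet> w p))"
      by (simp add: inner_sum_left)
    also have "\<dots> = u q * (q \<bullet> w p)"
      using T q others by (simp add: sum.remove)
    finally show False
      using nz p diag by simp
  qed
  then have "card (v ` I) \<le> DIM('e)"
    using independent_bound by blast
  then show ?thesis
    by (simp add: card_image inj)
qed

definition monomials :: "real ^ 'd \<Rightarrow> real ^ ('d set)"
  where "monomials x = (\<chi> S. \<Prod>i\<in>S. x $ i)"

definition complementary_monomials :: "real ^ 'd \<Rightarrow> real ^ ('d set)"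
  where "complementary_monomials y = (\<chi> S. \<Prod>i\<in>- S. - y $ i)"

lemma inner_monomials_complementary:
  "monomials x \<bullet> complementary_monomials y = (\<Prod>i\<in>UNIV. x $ i - y $ i)"
proof -
  have "(\<Prod>i\<in>UNIV. x $ i + - y $ i)
      = (\<Sum>S\<in>Pow UNIV. (\<Prod>i\<in>S. x $ i) * (\<Prod>i\<in>UNIV - S. - y $ i))"
    by (rule prod_add) simp
  then show ?thesis
    by (simp add: inner_vec_def monomials_def complementary_monomials_def Compl_eq_Diff_UNIV)
qed

lemma inner_monomials_eq_0_iff:
  "monomials x \<bullet> complementary_monomials y = 0 \<longleftrightarrow> intersecting x y"
  by (simp add: inner_monomials_complementary intersecting_def)

theorem theorem11:
  fixes a b :: "nat \<Rightarrow> real ^ 'd" and t :: nat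
  assumes "\<And>j. j \<in> {1..t} \<Longrightarrow> \<not> intersecting (a j) (b j)"
    and "\<And>j k. j \<in> {1..t} \<Longrightarrow> k \<in> {1..t} \<Longrightarrow> j \<noteq> k \<Longrightarrow>
      \<forall>x \<in> {a j, b j}. \<forall>y \<in> {a k, b k}. intersecting x y"
  shows "t \<le> 2 ^ (CARD('d) - 1)"
proof -
  \<comment> \<open>The Boolean selects a point of the pair, so negating it gives the partner.\<close>
  define pt where "pt = (\<lambda>(j, c). if c then a j else b j)"
  define partner where "partner = (\<lambda>(j, c). pt (j :: nat, \<not> c))"
  let ?I = "{1..t} \<times> (UNIV :: bool set)"
  have refl: "intersecting x x" for x :: "real ^ 'd"
    by (simp add: intersecting_def)
  have sym: "intersecting x y \<longleftrightarrow> intersecting y x" for x y :: "real ^ 'd"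
    unfolding intersecting_def by metis
  have diag: "\<not> intersecting (pt p) (partner p)" if "p \<in> ?I" for p
    using that assms(1) sym by (cases p) (auto simp: pt_def partner_def)
  have off_diag: "intersecting (pt p) (partner q)" if pq: "p \<in> ?I" "q \<in> ?I" "p \<noteq> q" for p q
  proof (cases "fst p = fst q")
    case True
    \<comment> \<open>The two indices differ only in the Boolean, so the partner of \<open>q\<close> is the point \<open>p\<close> itself.\<close>
    then have "partner q = pt p"
      using pq by (cases p; cases q) (auto simp: partner_def)
    then show ?thesis
      by (simp add: refl)
  next
    case False
    then show ?thesis
      using pq assms(2)[of "fst p" "fst q"]
      by (cases p; cases q) (auto simp: pt_def partner_def)
  qed
  have "card ?I \<le> DIM(real ^ ('d set))"
    by (rule card_le_DIM_biorthogonal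
          [where v = "\<lambda>p. monomials (pt p)" and w = "\<lambda>p. complementary_monomials (partner p)"])
      (use diag off_diag in \<open>simp_all only: inner_monomials_eq_0_iff not_False_eq_True\<close>)
  then have "2 * t \<le> 2 ^ CARD('d)"
    by (simp add: card_cartesian_product card_UNIV_bool mult.commute)
  also have "\<dots> = 2 * 2 ^ (CARD('d) - 1)"
    by (metis power_eq_if zero_less_card_finite less_numeral_extra(3))
  finally show ?thesis
    by simp
qed

end
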